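(* Let $R,S,T\in\mathbb R$ be the values of the invariants on a level set, and let $\mathfrak q=\mathfrak l/\mathbb R(2Y_1+Y_3)$ be the $3$-dimensional Lie algebra described in the context. If $R^2+S^2<T$, then $\mathfrak q$ is isomorphic to $\mathfrak{so}(3,\mathbb R)$. If $R^2+S^2>T$, then $\mathfrak q$ is isomorphic to $\mathfrak{sl}(2,\mathbb R)$. If $R^2+S^2=T$, then $\mathfrak q$ is isomorphic to the solvable Lie algebra with a basis $x_1,x_2,x_3$ satisfying $[x_2,x_3]=x_1$, $[x_3,x_1]=x_2$ and $[x_1,x_2]=0$.
   Context: The setting is a generic rank-$1$ Bäcklund transformation $(U^6,\mathcal B)$ relating two hyperbolic Monge-Ampère systems with a $1$-adapted coframing $(\omega^1,\dots,\omega^6)$ on $U$, $\mathcal B=\langle\omega^1,\omega^2,\omega^3\wedge\omega^4,\omega^5\wedge\omega^6\rangle$, whose structure functions are expressed in three functions $R,S,T$ by $$d\omega^1=-\beta_0\wedge\omega^1+\omega^3\wedge(\omega^4-\omega^1)+\omega^5\wedge\omega^6,\quad d\omega^2=-\alpha_0\wedge\omega^2+\omega^3\wedge\omega^4-\omega^5\wedge(\omega^6-\omega^2),$$ $$d\omega^3=-\alpha_1\wedge\omega^3-\alpha_2\wedge\omega^4+\omega^1\wedge\omega^2,\quad d\omega^4=-\alpha_3\wedge\omega^3-(\alpha_0-\alpha_1)\wedge\omega^4+\omega^5\wedge\omega^6,$$ $$d\omega^5=-\beta_1\wedge\omega^5-\beta_2\wedge\omega^6+\omega^1\wedge\omega^2,\quad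 d\omega^6=-\beta_3\wedge\omega^5-(\beta_0-\beta_1)\wedge\omega^6+\omega^3\wedge\omega^4,$$ with $\alpha_0=-R\omega^1+S\omega^2-\omega^3+\frac12(R+S)\omega^4+\frac12(R-S)\omega^6$, $\beta_0=-R\omega^1+S\omega^2+\frac12(R+S)\omega^4+\omega^5+\frac12(R-S)\omega^6$, $\alpha_1=(R-S)\omega^6$, $\alpha_2=(R+S)\omega^5+T\omega^6-\omega^1-\omega^2$, $\alpha_3=-\omega^4-\omega^6$, $\beta_1=(R+S)\omega^4$, $\beta_2=(R-S)\omega^3+T\omega^4+\omega^1-\omega^2$, $\beta_3=-\omega^4+\omega^6$, and $$dR=-R^2\omega^1+(RS-1)\omega^2+R\omega^3+\tfrac12(R^2+RS-1)\omega^4+R\omega^5+\tfrac12(R^2-RS+1)\omega^6,$$ $$dS=-(RS-1)\omega^1+S^2\omega^2-S\omega^3+\tfrac12(S^2+SR-1)\omega^4-S\omega^5+\tfrac12(SR-S^2-1)\omega^6,$$ $$dT=2(-RT+S)\omega^1+2(ST-R)\omega^2+2(R^2-S^2)(\omega^3+\omega^5)+T_4\omega^4+T_6\omega^6,$$ in the case where $\Phi=(R,S,T):U\to\mathbb R^3$ has rank $2$ and $T_4=(R+S)(T-1)$, $T_6=(R-S)(T+1)$. Let $X_1,\dots,X_6$ be the frame dual to $\omega^1,\dots,\omega^6$. The rank-$4$ distribution annihilated by $dR,dS,dT$ is spanned by $Y_1=RX_2+SX_1+X_5$, $Y_2=\frac12(X_1-X_2)+X_4$, $Y_3=X_3-X_5$,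 $Y_4=\frac12(X_1+X_2)+X_6$. On each level set of $\Phi$ (where $R,S,T$ are constants) these span a $4$-dimensional Lie algebra $\mathfrak l$ with $$[Y_1,Y_2]=\tfrac{R+S}{2}Y_3+Y_4,\quad [Y_1,Y_3]=0,\quad [Y_1,Y_4]=-Y_2+\tfrac{R-S}{2}Y_3,\quad [Y_2,Y_3]=(R+S)Y_3+2Y_4,$$ $$[Y_2,Y_4]=Y_1+(R-S)Y_2+\left(\tfrac12-T\right)Y_3-(R+S)Y_4,\quad [Y_3,Y_4]=2Y_2-(R-S)Y_3.$$ The element $2Y_1+Y_3$ is central in $\mathfrak l$. The quotient $\mathfrak q=\mathfrak l/\mathbb R(2Y_1+Y_3)$, with basis $e_1=[Y_2]$, $e_2=[Y_3]$, $e_3=[Y_4]$, satisfies $$[e_1,e_2]=(R+S)e_2+2e_3,\quad [e_1,e_3]=(R-S)e_1-Te_2-(R+S)e_3,\quad [e_2,e_3]=2e_1+(S-R)e_2.$$ *)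

theory Defs
  imports "HOL-Analysis.Analysis"
begin

text \<open>Real Lie algebras are given by carriers and operations rather than by type classes,
  since the elements of a quotient algebra are cosets.\<close>

record 'a lie_alg =
  carrier :: "'a set"
  zero :: 'a
  add :: "'a \<Rightarrow> 'a \<Rightarrow> 'a"
  scale :: "real \<Rightarrow> 'a \<Rightarrow> 'a"
  bracket :: "'a \<Rightarrow> 'a \<Rightarrow> 'a"

locale real_lie_algebra =
  fixes L :: "'a lie_alg"
  assumes zero_closed: "zero L \<in> carrier L"
    and add_closed: "\<lbrakk>x \<in> carrier L; y \<in> carrier L\<rbrakk> \<Longrightarrow> add L x y \<in> carrier L"
    and scale_closed: "x \<in> carrier L \<Longrightarrow> scale L c x \<in> carrier L"
    and bracket_closed: "\<lbrakk>x \<in> carrier L; y \<in> carrier L\<rbrakk> \<Longrightarrow> bracket L x y \<in> carrier L"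
    and add_assoc: "\<lbrakk>x \<in> carrier L; y \<in> carrier L; z \<in> carrier L\<rbrakk>
      \<Longrightarrow> add L (add L x y) z = add L x (add L y z)"
    and add_commute: "\<lbrakk>x \<in> carrier L; y \<in> carrier L\<rbrakk> \<Longrightarrow> add L x y = add L y x"
    and add_zero: "x \<in> carrier L \<Longrightarrow> add L (zero L) x = x"
    and add_inverse: "x \<in> carrier L \<Longrightarrow> \<exists>y\<in>carrier L. add L x y = zero L"
    and scale_add_right: "\<lbrakk>x \<in> carrier L; y \<in> carrier L\<rbrakk>
      \<Longrightarrow> scale L c (add L x y) = add L (scale L c x) (scale L c y)"
    and scale_add_left: "x \<in> carrier L
      \<Longrightarrow> scale L (c + d) x = add L (scale L c x) (scale L d x)"
    and scale_scale: "x \<in> carrier L \<Longrightarrow> scale L c (scale L d x) = scale L (c * d) x"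
    and scale_one: "x \<in> carrier L \<Longrightarrow> scale L 1 x = x"
    and bracket_add_left: "\<lbrakk>x \<in> carrier L; y \<in> carrier L; z \<in> carrier L\<rbrakk>
      \<Longrightarrow> bracket L (add L x y) z = add L (bracket L x z) (bracket L y z)"
    and bracket_add_right: "\<lbrakk>x \<in> carrier L; y \<in> carrier L; z \<in> carrier L\<rbrakk>
      \<Longrightarrow> bracket L x (add L y z) = add L (bracket L x y) (bracket L x z)"
    and bracket_scale_left: "\<lbrakk>x \<in> carrier L; y \<in> carrier L\<rbrakk>
      \<Longrightarrow> bracket L (scale L c x) y = scale L c (bracket L x y)"
    and bracket_scale_right: "\<lbrakk>x \<in> carrier L; y \<in> carrier L\<rbrakk>
      \<Longrightarrow> bracket L x (scale L c y) = scale L c (bracket L x y)"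
    and bracket_self: "x \<in> carrier L \<Longrightarrow> bracket L x x = zero L"
    and jacobi: "\<lbrakk>x \<in> carrier L; y \<in> carrier L; z \<in> carrier L\<rbrakk>
      \<Longrightarrow> add L (bracket L x (bracket L y z))
           (add L (bracket L y (bracket L z x)) (bracket L z (bracket L x y))) = zero L"

fun lincomb :: "'a lie_alg \<Rightarrow> real list \<Rightarrow> 'a list \<Rightarrow> 'a" where
  "lincomb L (c # cs) (v # vs) = add L (scale L c v) (lincomb L cs vs)"
| "lincomb L _ _ = zero L"

definition is_basis :: "'a lie_alg \<Rightarrow> 'a list \<Rightarrow> bool" where
  "is_basis L vs \<longleftrightarrow> set vs \<subseteq> carrier L \<and>
     (\<forall>x\<in>carrier L. \<exists>!cs. length cs = length vs \<and> lincomb L cs vs = x)"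

definition lie_subspace :: "'a lie_alg \<Rightarrow> 'a set \<Rightarrow> bool" where
  "lie_subspace L V \<longleftrightarrow> V \<subseteq> carrier L \<and> zero L \<in> V \<and>
     (\<forall>x\<in>V. \<forall>y\<in>V. add L x y \<in> V) \<and> (\<forall>c. \<forall>x\<in>V. scale L c x \<in> V)"

definition lie_span :: "'a lie_alg \<Rightarrow> 'a set \<Rightarrow> 'a set" where
  "lie_span L A = \<Inter>{V. lie_subspace L V \<and> A \<subseteq> V}"

primrec derived_series :: "'a lie_alg \<Rightarrow> nat \<Rightarrow> 'a set" where
  "derived_series L 0 = carrier L"
| "derived_series L (Suc k) =
     lie_span L {bracket L x y | x y. x \<in> derived_series L k \<and> y \<in> derived_series L k}"

definition solvable :: "'a lie_alg \<Rightarrow> bool" where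
  "solvable L \<longleftrightarrow> (\<exists>k. derived_series L k = {zero L})"

definition lie_iso :: "'a lie_alg \<Rightarrow> 'b lie_alg \<Rightarrow> bool"  (infix "\<cong>\<^sub>L" 50) where
  "L \<cong>\<^sub>L M \<longleftrightarrow> (\<exists>f. bij_betw f (carrier L) (carrier M) \<and>
     (\<forall>x\<in>carrier L. \<forall>y\<in>carrier L. f (add L x y) = add M (f x) (f y)) \<and>
     (\<forall>c. \<forall>x\<in>carrier L. f (scale L c x) = scale M c (f x)) \<and>
     (\<forall>x\<in>carrier L. \<forall>y\<in>carrier L. f (bracket L x y) = bracket M (f x) (f y)))"

definition lie_line :: "'a lie_alg \<Rightarrow> 'a \<Rightarrow> 'a set" where
  "lie_line L z = {scale L c z | c. True}"

text \<open>The quotient of \<open>L\<close> by an ideal \<open>I\<close>. The operations are written without choosing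
  representatives; adding \<open>I\<close> saturates the result, e.g. \<open>0 \<cdot> (x + I) = I\<close>.\<close>

definition lie_quotient :: "'a lie_alg \<Rightarrow> 'a set \<Rightarrow> 'a set lie_alg" where
  "lie_quotient L I = \<lparr>
     carrier = {{add L x i | i. i \<in> I} | x. x \<in> carrier L},
     zero = I,
     add = (\<lambda>C D. {add L x y | x y. x \<in> C \<and> y \<in> D}),
     scale = (\<lambda>c C. {add L (scale L c x) i | x i. x \<in> C \<and> i \<in> I}),
     bracket = (\<lambda>C D. {add L (bracket L x y) i | x y i. x \<in> C \<and> y \<in> D \<and> i \<in> I})\<rparr>"

definition matrix_lie_algebra :: "(real ^ 'n ^ 'n) set \<Rightarrow> (real ^ 'n ^ 'n) lie_alg" where
  "matrix_lie_algebra V = \<lparr>carrier = V, zero = 0, add = (+), scale = (*\<^sub>R),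
     bracket = (\<lambda>A B. A ** B - B ** A)\<rparr>"

definition so3 :: "(real ^ 3 ^ 3) lie_alg" where
  "so3 = matrix_lie_algebra {A. transpose A = - A}"

definition sl2 :: "(real ^ 2 ^ 2) lie_alg" where
  "sl2 = matrix_lie_algebra {A. trace A = 0}"

lemma real_lie_algebra_matrix:
  fixes V :: "(real ^ 'n ^ 'n) set"
  assumes "subspace V" and "\<And>A B. A \<in> V \<Longrightarrow> B \<in> V \<Longrightarrow> A ** B - B ** A \<in> V"
  shows "real_lie_algebra (matrix_lie_algebra V)"
proof -
  have [simp]: "(c *\<^sub>R A) ** B = c *\<^sub>R (A ** B)" for c and A B :: "real ^ 'n ^ 'n"
    by (rule scalar_matrix_assoc [symmetric])
  have [simp]: "A ** (c *\<^sub>R B) = c *\<^sub>R (A ** B)" for c and A B :: "real ^ 'n ^ 'n"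
    by (simp add: matrix_matrix_mult_def vec_eq_iff sum_distrib_left mult_ac)
  have sub_l: "A ** (B - C) = A ** B - A ** C" for A B C :: "real ^ 'n ^ 'n"
    by (simp add: matrix_matrix_mult_def vec_eq_iff algebra_simps sum_subtractf)
  have sub_r: "(A - B) ** C = A ** C - B ** C" for A B C :: "real ^ 'n ^ 'n"
    by (simp add: matrix_matrix_mult_def vec_eq_iff algebra_simps sum_subtractf)
  have add_r: "(A + B) ** C = A ** C + B ** C" for A B C :: "real ^ 'n ^ 'n"
    by (simp add: matrix_matrix_mult_def vec_eq_iff algebra_simps sum.distrib)
  have "\<exists>B\<in>V. A + B = 0" if "A \<in> V" for A
    using subspace_neg[OF assms(1) that] by (intro bexI[of _ "- A"]) auto
  then show ?thesis
    using assms(2) subspace_0[OF assms(1)] subspace_add[OF assms(1)] subspace_scale[OF assms(1)]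
    unfolding matrix_lie_algebra_def real_lie_algebra_def
    by (simp add: scaleR_add_left scaleR_add_right scaleR_diff_right
        matrix_add_ldistrib add_r sub_l sub_r matrix_mul_assoc)
qed

lemma real_lie_algebra_so3: "real_lie_algebra so3"
  unfolding so3_def
proof (rule real_lie_algebra_matrix)
  have t: "transpose 0 = (0 :: real ^ 3 ^ 3)"
    "transpose (A + B) = transpose A + transpose B"
    "transpose (A - B) = transpose A - transpose B"
    "transpose (c *\<^sub>R A) = c *\<^sub>R transpose A" for c and A B :: "real ^ 3 ^ 3"
    by (simp_all add: transpose_def vec_eq_iff)
  show "subspace {A :: real ^ 3 ^ 3. transpose A = - A}"
    by (simp add: subspace_def t)
  have neg: "(- A) ** (- B) = A ** B" for A B :: "real ^ 3 ^ 3"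
    by (simp add: matrix_matrix_mult_def vec_eq_iff)
  fix A B :: "real ^ 3 ^ 3"
  assume "A \<in> {A. transpose A = - A}" "B \<in> {A. transpose A = - A}"
  then show "A ** B - B ** A \<in> {A. transpose A = - A}"
    by (simp add: t matrix_transpose_mul neg)
qed

lemma real_lie_algebra_sl2: "real_lie_algebra sl2"
  unfolding sl2_def
proof (rule real_lie_algebra_matrix)
  show "subspace {A :: real ^ 2 ^ 2. trace A = 0}"
    by (simp add: subspace_def trace_add) (simp add: trace_def flip: sum_distrib_left)
  fix A B :: "real ^ 2 ^ 2"
  show "A ** B - B ** A \<in> {A. trace A = 0}"
    using trace_mul_sym[of A B] by (simp add: trace_sub)
qed

text \<open>The commutation relations of the fields \<open>Y\<^sub>1, \<dots>, Y\<^sub>4\<close> annihilated by \<open>dR, dS, dT\<close>,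
  restricted to a level set of \<open>(R, S, T)\<close>. There \<open>R, S, T\<close> are constants, so the
  restricted fields have constant structure coefficients.\<close>

definition level_set_brackets ::
    "real \<Rightarrow> real \<Rightarrow> real \<Rightarrow> 'a lie_alg \<Rightarrow> 'a \<Rightarrow> 'a \<Rightarrow> 'a \<Rightarrow> 'a \<Rightarrow> bool" where
  "level_set_brackets R S T L Y1 Y2 Y3 Y4 \<longleftrightarrow>
     bracket L Y1 Y2 = lincomb L [0, 0, (R + S) / 2, 1] [Y1, Y2, Y3, Y4] \<and>
     bracket L Y1 Y3 = zero L \<and>
     bracket L Y1 Y4 = lincomb L [0, -1, (R - S) / 2, 0] [Y1, Y2, Y3, Y4] \<and>
     bracket L Y2 Y3 = lincomb L [0, 0, R + S, 2] [Y1, Y2, Y3, Y4] \<and>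
     bracket L Y2 Y4 = lincomb L [1, R - S, 1 / 2 - T, - (R + S)] [Y1, Y2, Y3, Y4] \<and>
     bracket L Y3 Y4 = lincomb L [0, 2, - (R - S), 0] [Y1, Y2, Y3, Y4]"

end

theory Submission
  imports Defs
begin

text \<open>The quotient is unimodular, so its bracket is \<open>[u, v] = N (u \<times> v)\<close> for a symmetric matrix
  \<open>N\<close>, read here as a quadratic form on the dual space. In the basis \<open>e\<^sub>1, e\<^sub>2, e\<^sub>3\<close> the relations
  give \<open>N = 2 e\<^sub>1\<^sup>2 - 2 (R - S) e\<^sub>1 e\<^sub>2 + T e\<^sub>2\<^sup>2 + 2 (R + S) e\<^sub>2 e\<^sub>3 + 2 e\<^sub>3\<^sup>2\<close>, and completing squares turns
  this into \<open>N = 2 f\<^sub>1\<^sup>2 + D f\<^sub>2\<^sup>2 + 2 f\<^sub>3\<^sup>2\<close> with \<open>D = T - R\<^sup>2 - S\<^sup>2\<close>, where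
  \<open>f\<^sub>1 = e\<^sub>1 - (R - S)/2 e\<^sub>2\<close>, \<open>f\<^sub>2 = e\<^sub>2\<close> and \<open>f\<^sub>3 = e\<^sub>3 + (R + S)/2 e\<^sub>2\<close>. Since this change of basis has
  determinant one, it preserves the cross product formula and yields
  \<open>[f\<^sub>2, f\<^sub>3] = 2 f\<^sub>1\<close>, \<open>[f\<^sub>3, f\<^sub>1] = D f\<^sub>2\<close>, \<open>[f\<^sub>1, f\<^sub>2] = 2 f\<^sub>3\<close>. The cases
  \<open>D > 0\<close>, \<open>D < 0\<close> and \<open>D = 0\<close> are the signatures \<open>(3, 0)\<close>, \<open>(2, 1)\<close> and \<open>(2, 0)\<close> of \<open>N\<close>.

  No coset representatives have to be chosen: the map \<open>Y\<^sub>1 \<mapsto> - f\<^sub>2/2\<close>, \<open>Y\<^sub>2 \<mapsto> e\<^sub>1\<close>, \<open>Y\<^sub>3 \<mapsto> e\<^sub>2\<close>, \<open>Y\<^sub>4 \<mapsto> e\<^sub>3\<close> is a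
  homomorphism onto the diagonal model (\<open>milnor_algebra\<close>) with kernel \<open>\<real>(2 Y\<^sub>1 + Y\<^sub>3)\<close>, so the
  first isomorphism theorem (\<open>first_isomorphism\<close>) identifies the quotient with that model
  (\<open>quotient_iso_milnor\<close>). For \<open>D \<noteq> 0\<close> rescaling the basis vectors identifies the model with \<open>so3\<close> or
  \<open>sl2\<close>; for \<open>D = 0\<close> the model is itself the solvable algebra.\<close>

section \<open>Linear algebra in a Lie algebra with a carrier\<close>

context real_lie_algebra
begin

lemma add_left_cancel:
  assumes "x \<in> carrier L" "y \<in> carrier L" "z \<in> carrier L" and eq: "add L x y = add L x z"
  shows "y = z"
proof -
  obtain w where w: "w \<in> carrier L" "add L x w = zero L"
    using add_inverse assms(1) by blast
  have "add L w (add L x u) = u" if "u \<in> carrier L" for u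
    using w assms(1) that by (metis add_assoc add_commute add_zero)
  then show ?thesis
    using assms by metis
qed

lemma scale_zero_left: "x \<in> carrier L \<Longrightarrow> scale L 0 x = zero L"
  using scale_add_left[of x 1 0] add_left_cancel[of x "scale L 0 x" "zero L"]
  by (simp add: scale_one scale_closed zero_closed add_zero add_commute[of x "zero L"])

lemma scale_zero_right: "scale L c (zero L) = zero L"
  using scale_scale[OF zero_closed, of c 0] by (simp add: scale_zero_left zero_closed)

lemma add_scale_minus_one: "x \<in> carrier L \<Longrightarrow> add L x (scale L (-1) x) = zero L"
  using scale_add_left[of x 1 "-1"] by (simp add: scale_one scale_zero_left)

lemma add_zero_right: "x \<in> carrier L \<Longrightarrow> add L x (zero L) = x"
  by (simp add: add_commute[of x "zero L"] zero_closed add_zero)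

lemma add_difference:
  assumes "x \<in> carrier L" "z \<in> carrier L"
  shows "add L x (add L z (scale L (-1) x)) = z"
  using assms
  by (metis add_assoc add_commute add_scale_minus_one add_zero scale_closed)

lemma bracket_zero_left: "y \<in> carrier L \<Longrightarrow> bracket L (zero L) y = zero L"
  using bracket_scale_left[OF zero_closed, of y 0]
  by (simp add: scale_zero_left zero_closed bracket_closed)

lemma bracket_skew:
  assumes x: "x \<in> carrier L" and y: "y \<in> carrier L"
  shows "bracket L y x = scale L (-1) (bracket L x y)"
proof -
  note c = x y add_closed bracket_closed scale_closed zero_closed
  have "zero L = bracket L (add L x y) (add L x y)"
    by (simp add: bracket_self c)
  also have "\<dots> = add L (bracket L x (add L x y)) (bracket L y (add L x y))"
    by (rule bracket_add_left) (simp_all add: c)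
  also have "\<dots> = add L (bracket L x y) (bracket L y x)"
    by (simp add: c bracket_add_right bracket_self add_zero add_zero_right)
  finally show ?thesis
    using add_left_cancel[of "bracket L x y" "bracket L y x" "scale L (-1) (bracket L x y)"]
    by (simp add: c add_scale_minus_one)
qed

lemma lincomb_closed: "set vs \<subseteq> carrier L \<Longrightarrow> lincomb L cs vs \<in> carrier L"
proof (induction vs arbitrary: cs)
  case Nil
  then show ?case by (simp add: zero_closed)
next
  case (Cons v vs)
  then show ?case
    by (cases cs) (auto simp: zero_closed add_closed scale_closed)
qed

lemma add_interchange:
  assumes "a \<in> carrier L" "b \<in> carrier L" "c \<in> carrier L" "d \<in> carrier L"
  shows "add L (add L a b) (add L c d) = add L (add L a c) (add L b d)"
proof -
  have "add L b (add L c d) = add L c (add L b d)"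
    using assms by (metis add_assoc add_commute)
  then show ?thesis
    using assms by (simp add: add_assoc add_closed)
qed

lemma lincomb_add:
  assumes "length cs = length vs" "length ds = length vs" "set vs \<subseteq> carrier L"
  shows "lincomb L (map2 (+) cs ds) vs = add L (lincomb L cs vs) (lincomb L ds vs)"
  using assms
proof (induction vs arbitrary: cs ds)
  case Nil
  then show ?case by (simp add: add_zero zero_closed)
next
  case (Cons v vs)
  then obtain c cs' d ds' where "cs = c # cs'" "ds = d # ds'"
    by (metis length_Suc_conv)
  with Cons show ?case
    by (simp add: scale_add_left add_interchange lincomb_closed scale_closed)
qed

lemma lincomb_scale:
  assumes "set vs \<subseteq> carrier L"
  shows "lincomb L (map ((*) c) cs) vs = scale L c (lincomb L cs vs)"
  using assms
proof (induction vs arbitrary: cs)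
  case Nil
  then show ?case by (simp add: scale_zero_right)
next
  case (Cons v vs)
  then show ?case
    by (cases cs)
      (auto simp: scale_zero_right scale_add_right scale_scale lincomb_closed scale_closed)
qed

end

section \<open>Homomorphisms\<close>

definition lie_linear :: "'a lie_alg \<Rightarrow> 'b lie_alg \<Rightarrow> ('a \<Rightarrow> 'b) \<Rightarrow> bool" where
  "lie_linear L M f \<longleftrightarrow> f ` carrier L \<subseteq> carrier M \<and>
     (\<forall>x\<in>carrier L. \<forall>y\<in>carrier L. f (add L x y) = add M (f x) (f y)) \<and>
     (\<forall>c. \<forall>x\<in>carrier L. f (scale L c x) = scale M c (f x))"

definition lie_hom :: "'a lie_alg \<Rightarrow> 'b lie_alg \<Rightarrow> ('a \<Rightarrow> 'b) \<Rightarrow> bool" where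
  "lie_hom L M f \<longleftrightarrow> lie_linear L M f \<and>
     (\<forall>x\<in>carrier L. \<forall>y\<in>carrier L. f (bracket L x y) = bracket M (f x) (f y))"

lemma lie_linear_zero:
  assumes "real_lie_algebra L" "real_lie_algebra M" "lie_linear L M f"
  shows "f (zero L) = zero M"
proof -
  interpret L: real_lie_algebra L by fact
  interpret M: real_lie_algebra M by fact
  have "f (scale L 0 (zero L)) = scale M 0 (f (zero L))" "f (zero L) \<in> carrier M"
    using assms(3) L.zero_closed by (auto simp: lie_linear_def)
  then show ?thesis
    by (simp add: L.scale_zero_right M.scale_zero_left)
qed

lemma linear_extension:
  assumes L: "real_lie_algebra L" and M: "real_lie_algebra M"
    and vs: "is_basis L vs" and ms: "set ms \<subseteq> carrier M" and len: "length ms = length vs"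
  obtains f where "lie_linear L M f"
    and "\<And>cs. length cs = length vs \<Longrightarrow> f (lincomb L cs vs) = lincomb M cs ms"
proof -
  interpret L: real_lie_algebra L by fact
  interpret M: real_lie_algebra M by fact
  have sub: "set vs \<subseteq> carrier L" using vs by (simp add: is_basis_def)
  define coords where "coords x = (THE cs. length cs = length vs \<and> lincomb L cs vs = x)" for x
  have coords: "coords (lincomb L cs vs) = cs" if "length cs = length vs" for cs
    unfolding coords_def using vs that L.lincomb_closed[OF sub, of cs]
    by (intro the1_equality) (auto simp: is_basis_def)
  have ex: "\<exists>cs. length cs = length vs \<and> x = lincomb L cs vs" if "x \<in> carrier L" for x
    using vs that unfolding is_basis_def by metis
  define f where "f x = lincomb M (coords x) ms" for x
  have f: "f (lincomb L cs vs) = lincomb M cs ms" if "length cs = length vs" for cs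
    using coords[OF that] by (simp add: f_def)
  have "f (add L x y) = add M (f x) (f y)" if x: "x \<in> carrier L" and y: "y \<in> carrier L" for x y
  proof -
    obtain cs ds where "length cs = length vs" "x = lincomb L cs vs"
      "length ds = length vs" "y = lincomb L ds vs"
      using ex[OF x] ex[OF y] by blast
    then show ?thesis
      using f[of "map2 (+) cs ds"] sub ms len by (simp add: f L.lincomb_add M.lincomb_add)
  qed
  moreover have "f (scale L c x) = scale M c (f x)" if x: "x \<in> carrier L" for c x
  proof -
    obtain cs where "length cs = length vs" "x = lincomb L cs vs"
      using ex[OF x] by blast
    then show ?thesis
      using f[of "map ((*) c) cs"] sub ms by (simp add: f L.lincomb_scale M.lincomb_scale)
  qed
  moreover have "f x \<in> carrier M" for x
    using ms by (simp add: f_def M.lincomb_closed)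
  ultimately have "lie_linear L M f"
    by (auto simp: lie_linear_def)
  with f show ?thesis by (rule that[rotated])
qed

text \<open>Both sides of the homomorphism law are linear in the first argument.\<close>

lemma hom_law_lincomb:
  assumes L: "real_lie_algebra L" and M: "real_lie_algebra M" and f: "lie_linear L M f"
    and vs: "set vs \<subseteq> carrier L" and y: "y \<in> carrier L"
    and law: "\<And>v. v \<in> set vs \<Longrightarrow> f (bracket L v y) = bracket M (f v) (f y)"
  shows "f (bracket L (lincomb L cs vs) y) = bracket M (f (lincomb L cs vs)) (f y)"
proof -
  interpret L: real_lie_algebra L by fact
  interpret M: real_lie_algebra M by fact
  have fc: "\<And>x. x \<in> carrier L \<Longrightarrow> f x \<in> carrier M"
    and fa: "\<And>x y. x \<in> carrier L \<Longrightarrow> y \<in> carrier L \<Longrightarrow> f (add L x y) = add M (f x) (f y)"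
    and fs: "\<And>c x. x \<in> carrier L \<Longrightarrow> f (scale L c x) = scale M c (f x)"
    using f by (auto simp: lie_linear_def)
  have f0: "f (zero L) = zero M" using L M f by (rule lie_linear_zero)
  show ?thesis using vs law
  proof (induction vs arbitrary: cs)
    case Nil
    then show ?case by (simp add: L.bracket_zero_left M.bracket_zero_left y f0 fc)
  next
    case (Cons v vs)
    then show ?case
      using y by (cases cs)
        (auto simp: L.bracket_zero_left M.bracket_zero_left f0 fc fa fs L.bracket_add_left
          L.bracket_scale_left L.lincomb_closed L.scale_closed L.bracket_closed
          M.bracket_add_left M.bracket_scale_left M.scale_closed)
  qed
qed

text \<open>Antisymmetry of both brackets supplies the diagonal pairs and those in reverse order.\<close>

lemma lie_hom_from_basis:
  assumes L: "real_lie_algebra L" and M: "real_lie_algebra M" and f: "lie_linear L M f"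
    and vs: "is_basis L vs"
    and pairs: "sorted_wrt (\<lambda>u v. f (bracket L u v) = bracket M (f u) (f v)) vs"
  shows "lie_hom L M f"
proof -
  interpret L: real_lie_algebra L by fact
  interpret M: real_lie_algebra M by fact
  have fc: "\<And>x. x \<in> carrier L \<Longrightarrow> f x \<in> carrier M"
    and fs: "\<And>c x. x \<in> carrier L \<Longrightarrow> f (scale L c x) = scale M c (f x)"
    using f by (auto simp: lie_linear_def)
  have f0: "f (zero L) = zero M" using L M f by (rule lie_linear_zero)
  have sub: "set vs \<subseteq> carrier L" using vs by (simp add: is_basis_def)
  have ex: "\<exists>cs. x = lincomb L cs vs" if "x \<in> carrier L" for x
    using vs that unfolding is_basis_def by metis
  let ?law = "\<lambda>u v. f (bracket L u v) = bracket M (f u) (f v)"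
  have flip: "?law v u" if "?law u v" "u \<in> carrier L" "v \<in> carrier L" for u v
    using that by (simp add: L.bracket_skew[of u v] M.bracket_skew[of "f u" "f v"]
        L.bracket_closed fs fc)
  have basis: "?law u v" if "u \<in> set vs" "v \<in> set vs" for u v
  proof -
    obtain i j where ij: "i < length vs" "j < length vs" "u = vs ! i" "v = vs ! j"
      using \<open>u \<in> set vs\<close> \<open>v \<in> set vs\<close> by (metis in_set_conv_nth)
    have uv: "u \<in> carrier L" "v \<in> carrier L" using that sub by auto
    consider "i < j" | "i = j" | "j < i" by linarith
    then show ?thesis
    proof cases
      case 1
      with pairs ij show ?thesis by (simp add: sorted_wrt_iff_nth_less)
    next
      case 2
      with ij uv show ?thesis by (simp add: L.bracket_self M.bracket_self fc f0)
    next
      case 3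
      with pairs ij have "?law v u" by (simp add: sorted_wrt_iff_nth_less)
      with flip uv show ?thesis by blast
    qed
  qed
  have left: "?law x v" if "x \<in> carrier L" "v \<in> set vs" for x v
    using ex[OF that(1)] hom_law_lincomb[OF L M f sub, of v] basis that(2) sub by blast
  have "?law x y" if "x \<in> carrier L" "y \<in> carrier L" for x y
  proof (rule flip[OF _ that(2,1)])
    show "?law y x"
      using ex[OF that(2)] hom_law_lincomb[OF L M f sub that(1)] flip[OF left[OF that(1)]]
        that(1) sub by blast
  qed
  with f show ?thesis by (simp add: lie_hom_def)
qed

lemma lie_iso_trans:
  assumes "K \<cong>\<^sub>L L" "L \<cong>\<^sub>L M"
  shows "K \<cong>\<^sub>L M"
proof -
  obtain f where f: "bij_betw f (carrier K) (carrier L)"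
    "\<forall>x\<in>carrier K. \<forall>y\<in>carrier K. f (add K x y) = add L (f x) (f y)"
    "\<forall>c. \<forall>x\<in>carrier K. f (scale K c x) = scale L c (f x)"
    "\<forall>x\<in>carrier K. \<forall>y\<in>carrier K. f (bracket K x y) = bracket L (f x) (f y)"
    using assms(1) by (auto simp: lie_iso_def)
  obtain g where g: "bij_betw g (carrier L) (carrier M)"
    "\<forall>x\<in>carrier L. \<forall>y\<in>carrier L. g (add L x y) = add M (g x) (g y)"
    "\<forall>c. \<forall>x\<in>carrier L. g (scale L c x) = scale M c (g x)"
    "\<forall>x\<in>carrier L. \<forall>y\<in>carrier L. g (bracket L x y) = bracket M (g x) (g y)"
    using assms(2) by (auto simp: lie_iso_def)
  have "f x \<in> carrier L" if "x \<in> carrier K" for x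
    using f(1) that by (auto simp: bij_betw_def)
  then show ?thesis
    unfolding lie_iso_def using f g bij_betw_trans[OF f(1) g(1)]
    by (intro exI[of _ "g \<circ> f"]) auto
qed

text \<open>The cosets of the kernel are exactly the fibres of \<open>f\<close>. The operations on the quotient are
  complex products saturated by the kernel, on which \<open>f\<close> is constant as well, so each
  homomorphism law is the equality of two constants.\<close>

lemma first_isomorphism:
  assumes L: "real_lie_algebra L" and M: "real_lie_algebra M" and hom: "lie_hom L M f"
    and surj: "f ` carrier L = carrier M"
    and ker: "I = {x \<in> carrier L. f x = zero M}"
  shows "lie_quotient L I \<cong>\<^sub>L M"
proof -
  interpret L: real_lie_algebra L by fact
  interpret M: real_lie_algebra M by fact
  have lin: "lie_linear L M f" using hom by (simp add: lie_hom_def)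
  have fc: "\<And>x. x \<in> carrier L \<Longrightarrow> f x \<in> carrier M"
    and fa: "\<And>x y. x \<in> carrier L \<Longrightarrow> y \<in> carrier L \<Longrightarrow> f (add L x y) = add M (f x) (f y)"
    and fs: "\<And>c x. x \<in> carrier L \<Longrightarrow> f (scale L c x) = scale M c (f x)"
    and fb: "\<And>x y. x \<in> carrier L \<Longrightarrow> y \<in> carrier L
      \<Longrightarrow> f (bracket L x y) = bracket M (f x) (f y)"
    using hom by (auto simp: lie_hom_def lie_linear_def)
  have zero_I: "zero L \<in> I"
    using lie_linear_zero[OF L M lin] by (simp add: ker L.zero_closed)
  define fibre where "fibre m = {x \<in> carrier L. f x = m}" for m
  have coset: "{add L x i | i. i \<in> I} = fibre (f x)" if x: "x \<in> carrier L" for x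
  proof (intro set_eqI iffI)
    fix z assume "z \<in> {add L x i | i. i \<in> I}"
    then show "z \<in> fibre (f x)"
      using x by (auto simp: fibre_def ker fa fc M.add_zero_right L.add_closed)
  next
    fix z assume "z \<in> fibre (f x)"
    then have z: "z \<in> carrier L" "f z = f x" by (auto simp: fibre_def)
    have "add L z (scale L (-1) x) \<in> I"
      using x z by (simp add: ker fa fs fc L.add_closed L.scale_closed M.add_scale_minus_one)
    moreover have "z = add L x (add L z (scale L (-1) x))"
      using L.add_difference x z by simp
    ultimately show "z \<in> {add L x i | i. i \<in> I}" by blast
  qed
  define g where "g C = the_elem (f ` C)" for C
  have g: "g C = m" if "C \<noteq> {}" "\<And>z. z \<in> C \<Longrightarrow> f z = m" for C m
  proof -
    have "f ` C = {m}" using that by auto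
    then show ?thesis by (simp add: g_def)
  qed
  have carrier_q: "carrier (lie_quotient L I) = fibre ` carrier M"
  proof -
    have "carrier (lie_quotient L I) = (\<lambda>x. {add L x i | i. i \<in> I}) ` carrier L"
      by (auto simp: lie_quotient_def)
    also have "\<dots> = (\<lambda>x. fibre (f x)) ` carrier L"
      using coset by (rule image_cong[OF refl])
    finally show ?thesis
      by (simp add: image_image flip: surj)
  qed
  have ne: "fibre m \<noteq> {}" if "m \<in> carrier M" for m
    using that unfolding surj[symmetric] by (auto simp: fibre_def)
  have g_fibre: "g (fibre m) = m" if "m \<in> carrier M" for m
    using ne[OF that] by (intro g) (auto simp: fibre_def)
  have "bij_betw g (carrier (lie_quotient L I)) (carrier M)"
    unfolding carrier_q
    by (rule bij_betw_byWitness[where f' = fibre]) (auto simp: g_fibre)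
  moreover have "g (add (lie_quotient L I) (fibre m) (fibre n)) = add M m n"
    if "m \<in> carrier M" "n \<in> carrier M" for m n
    using ne[OF that(1)] ne[OF that(2)]
    by (intro g) (auto simp: lie_quotient_def fibre_def fa)
  moreover have "g (scale (lie_quotient L I) c (fibre m)) = scale M c m"
    if "m \<in> carrier M" for c m
    using ne[OF that] zero_I that
    by (intro g) (auto simp: lie_quotient_def fibre_def ker fa fs L.scale_closed
        M.add_zero_right M.scale_closed)
  moreover have "g (bracket (lie_quotient L I) (fibre m) (fibre n)) = bracket M m n"
    if "m \<in> carrier M" "n \<in> carrier M" for m n
    using ne[OF that(1)] ne[OF that(2)] zero_I that
    by (intro g) (auto simp: lie_quotient_def fibre_def ker fa fb L.bracket_closed
        M.add_zero_right M.bracket_closed)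
  ultimately show ?thesis
    unfolding lie_iso_def by (intro exI[of _ g]) (auto simp: carrier_q g_fibre)
qed

section \<open>The diagonal unimodular algebras\<close>

text \<open>Milnor's normal form of a three-dimensional unimodular Lie algebra:
  \<open>[f\<^sub>2, f\<^sub>3] = p f\<^sub>1\<close>, \<open>[f\<^sub>3, f\<^sub>1] = q f\<^sub>2\<close>, \<open>[f\<^sub>1, f\<^sub>2] = r f\<^sub>3\<close> for the standard basis of \<open>\<real>\<^sup>3\<close>.\<close>

definition milnor_algebra :: "real \<Rightarrow> real \<Rightarrow> real \<Rightarrow> (real ^ 3) lie_alg" where
  "milnor_algebra p q r = \<lparr>carrier = UNIV, zero = 0, add = (+), scale = (*\<^sub>R),
     bracket = (\<lambda>u v. vector [p * (u$2 * v$3 - u$3 * v$2), q * (u$3 * v$1 - u$1 * v$3),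
       r * (u$1 * v$2 - u$2 * v$1)])\<rparr>"

lemma milnor_algebra_simps [simp]:
  "carrier (milnor_algebra p q r) = UNIV"
  "zero (milnor_algebra p q r) = 0"
  "add (milnor_algebra p q r) = (+)"
  "scale (milnor_algebra p q r) = (*\<^sub>R)"
  "bracket (milnor_algebra p q r) u v =
     vector [p * (u$2 * v$3 - u$3 * v$2), q * (u$3 * v$1 - u$1 * v$3),
       r * (u$1 * v$2 - u$2 * v$1)]"
  by (simp_all add: milnor_algebra_def)

lemma real_lie_algebra_milnor: "real_lie_algebra (milnor_algebra p q r)"
proof unfold_locales
  fix x :: "real ^ 3"
  show "\<exists>y\<in>carrier (milnor_algebra p q r).
      add (milnor_algebra p q r) x y = zero (milnor_algebra p q r)"
    by (intro bexI[of _ "- x"]) auto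
qed (simp_all add: vec_eq_iff forall_3 algebra_simps)

text \<open>Here the span of the first and third basis vectors is an abelian ideal that contains
  every bracket.\<close>

lemma solvable_milnor: "solvable (milnor_algebra p 0 r)"
proof -
  let ?M = "milnor_algebra p 0 r"
  have span: "lie_span ?M A \<subseteq> V" if "lie_subspace ?M V" "A \<subseteq> V" for A V
    using that by (auto simp: lie_span_def)
  have "derived_series ?M 1 \<subseteq> {v. v$2 = 0}"
    by (simp, rule span) (auto simp: lie_subspace_def)
  then have "v$2 = 0" if "v \<in> derived_series ?M 1" for v
    using that by blast
  then have "{bracket ?M x y | x y. x \<in> derived_series ?M 1 \<and> y \<in> derived_series ?M 1} \<subseteq> {0}"
    by (auto simp del: One_nat_def simp: vec_eq_iff forall_3)
  then have "derived_series ?M (Suc 1) \<subseteq> {0}"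
    unfolding derived_series.simps(2)[of ?M 1] by (intro span) (simp_all add: lie_subspace_def)
  moreover have "0 \<in> derived_series ?M (Suc 1)"
    unfolding derived_series.simps(2)[of ?M 1] by (auto simp: lie_span_def lie_subspace_def)
  ultimately have "derived_series ?M (Suc 1) = {zero ?M}" by auto
  then show ?thesis unfolding solvable_def by blast
qed

text \<open>The factors are forced: with \<open>s\<^sup>2 = 2 D\<close>, the elements \<open>f\<^sub>1/s\<close>, \<open>f\<^sub>2/2\<close>, \<open>f\<^sub>3/s\<close> satisfy the
  relations of the cross product, hence correspond to the infinitesimal rotations about
  the three axes.\<close>

lemma milnor_iso_so3:
  assumes "D > 0"
  shows "milnor_algebra 2 D 2 \<cong>\<^sub>L so3"
proof -
  define s where "s = sqrt (2 * D)"
  have s: "s * s = 2 * D" "s \<noteq> 0" using assms by (simp_all add: s_def)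
  define f :: "real ^ 3 \<Rightarrow> real ^ 3 ^ 3" where
    "f v = vector [vector [0, - s * v$3, 2 * v$2],
                   vector [s * v$3, 0, - s * v$1],
                   vector [- 2 * v$2, s * v$1, 0]]" for v
  define g :: "real ^ 3 ^ 3 \<Rightarrow> real ^ 3" where
    "g A = vector [A$3$2 / s, A$1$3 / 2, A$2$1 / s]" for A
  have skew: "A$i$j = - A$j$i" if "transpose A = - A" for A :: "real ^ 3 ^ 3" and i j
    using arg_cong[OF that, of "\<lambda>M. M$i$j"] by (simp add: transpose_def)
  have "bij_betw f UNIV {A. transpose A = - A}"
  proof (rule bij_betw_byWitness[where f' = g])
    show "\<forall>v\<in>UNIV. g (f v) = v"
      using s(2) by (simp add: f_def g_def vec_eq_iff forall_3)
    show "\<forall>A\<in>{A. transpose A = - A}. f (g A) = A"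
    proof clarify
      fix A :: "real ^ 3 ^ 3" assume A: "transpose A = - A"
      have "A$1$1 = 0" "A$2$2 = 0" "A$3$3 = 0" "A$1$2 = - A$2$1" "A$2$3 = - A$3$2"
        "A$3$1 = - A$1$3"
        using skew[OF A, of 1 1] skew[OF A, of 2 2] skew[OF A, of 3 3] skew[OF A, of 1 2]
          skew[OF A, of 2 3] skew[OF A, of 3 1] by simp_all
      then show "f (g A) = A"
        using s(2) by (simp add: f_def g_def vec_eq_iff forall_3)
    qed
    show "f ` UNIV \<subseteq> {A. transpose A = - A}"
      by (auto simp: f_def transpose_def vec_eq_iff forall_3)
  qed auto
  moreover have "f (bracket (milnor_algebra 2 D 2) u v) = f u ** f v - f v ** f u" for u v
  proof -
    have D: "D = s * s / 2" using s(1) by simp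
    show ?thesis
      by (simp add: D f_def vec_eq_iff forall_3 matrix_matrix_mult_def sum_3 field_simps)
  qed
  moreover have "f (u + v) = f u + f v" "f (c *\<^sub>R v) = c *\<^sub>R f v" for c u v
    by (simp_all add: f_def vec_eq_iff forall_3 field_simps)
  ultimately show ?thesis
    unfolding lie_iso_def so3_def matrix_lie_algebra_def
    by (intro exI[of _ f]) (simp del: milnor_algebra_simps(5))
qed

text \<open>With \<open>s\<^sup>2 = - 2 D\<close>, the elements \<open>f\<^sub>1/s\<close> and \<open>f\<^sub>3/s\<close> correspond to halves of the symmetric
  matrices \<open>diag (1, -1)\<close> and \<open>antidiag (1, 1)\<close>, and \<open>f\<^sub>2\<close>, whose coefficient in the form is
  negative, to an infinitesimal rotation of the plane.\<close>

lemma milnor_iso_sl2: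
  assumes "D < 0"
  shows "milnor_algebra 2 D 2 \<cong>\<^sub>L sl2"
proof -
  define s where "s = sqrt (- 2 * D)"
  have s: "s * s = - 2 * D" "s \<noteq> 0" using assms by (simp_all add: s_def)
  define f :: "real ^ 3 \<Rightarrow> real ^ 2 ^ 2" where
    "f v = vector [vector [s * v$1 / 2, s * v$3 / 2 + v$2],
                   vector [s * v$3 / 2 - v$2, - s * v$1 / 2]]" for v
  define g :: "real ^ 2 ^ 2 \<Rightarrow> real ^ 3" where
    "g A = vector [2 * A$1$1 / s, (A$1$2 - A$2$1) / 2, (A$1$2 + A$2$1) / s]" for A
  have "bij_betw f UNIV {A. trace A = 0}"
  proof (rule bij_betw_byWitness[where f' = g])
    show "\<forall>v\<in>UNIV. g (f v) = v"
      using s(2) by (simp add: f_def g_def vec_eq_iff forall_3 field_simps)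
    show "\<forall>A\<in>{A. trace A = 0}. f (g A) = A"
      using s(2) by (auto simp: f_def g_def vec_eq_iff forall_2 trace_def sum_2 field_simps)
    show "f ` UNIV \<subseteq> {A. trace A = 0}"
      by (auto simp: f_def trace_def sum_2)
  qed auto
  moreover have "f (bracket (milnor_algebra 2 D 2) u v) = f u ** f v - f v ** f u" for u v
  proof -
    have D: "D = - (s * s) / 2" using s(1) by simp
    show ?thesis
      by (simp add: D f_def vec_eq_iff forall_2 matrix_matrix_mult_def sum_2 field_simps)
  qed
  moreover have "f (u + v) = f u + f v" "f (c *\<^sub>R v) = c *\<^sub>R f v" for c u v
    by (simp_all add: f_def vec_eq_iff forall_2 field_simps)
  ultimately show ?thesis
    unfolding lie_iso_def sl2_def matrix_lie_algebra_def
    by (intro exI[of _ f]) (simp del: milnor_algebra_simps(5))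
qed

section \<open>The quotient of the level-set algebra\<close>

text \<open>The image of \<open>Y\<^sub>1\<close> is dictated by \<open>2 Y\<^sub>1 + Y\<^sub>3 \<mapsto> 0\<close>; the images of \<open>Y\<^sub>2\<close>, \<open>Y\<^sub>3\<close>, \<open>Y\<^sub>4\<close> are the
  coordinates of \<open>e\<^sub>1\<close>, \<open>e\<^sub>2\<close>, \<open>e\<^sub>3\<close> in the basis that diagonalises the structure form.\<close>

lemma quotient_iso_milnor:
  assumes L: "real_lie_algebra L" and basis: "is_basis L [Y1, Y2, Y3, Y4]"
    and br: "level_set_brackets R S T L Y1 Y2 Y3 Y4"
  shows "lie_quotient L (lie_line L (lincomb L [2, 0, 1, 0] [Y1, Y2, Y3, Y4]))
    \<cong>\<^sub>L milnor_algebra 2 (T - R\<^sup>2 - S\<^sup>2) 2"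
proof -
  interpret L: real_lie_algebra L by fact
  let ?M = "milnor_algebra 2 (T - R\<^sup>2 - S\<^sup>2) 2"
  let ?Y = "[Y1, Y2, Y3, Y4]"
  define m1 m2 m3 m4 :: "real ^ 3" where
    "m1 = vector [0, - 1 / 2, 0]" and "m2 = vector [1, (R - S) / 2, 0]"
    and "m3 = vector [0, 1, 0]" and "m4 = vector [0, - (R + S) / 2, 1]"
  note m = m1_def m2_def m3_def m4_def
  interpret M: real_lie_algebra ?M by (rule real_lie_algebra_milnor)
  have Y: "Y1 \<in> carrier L" "Y2 \<in> carrier L" "Y3 \<in> carrier L" "Y4 \<in> carrier L"
    using basis by (auto simp: is_basis_def)
  obtain f where lin: "lie_linear L ?M f"
    and f_lincomb: "\<And>cs. length cs = length ?Y \<Longrightarrow> f (lincomb L cs ?Y) = lincomb ?M cs [m1, m2, m3, m4]"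
    by (rule linear_extension[OF L M.real_lie_algebra_axioms basis, of "[m1, m2, m3, m4]"]) auto
  have f: "f (lincomb L [a, b, c, d] ?Y)
      = vector [b, b * (R - S) / 2 + c - d * (R + S) / 2 - a / 2, d]" for a b c d
    using f_lincomb[of "[a, b, c, d]"]
    by (simp add: m vec_eq_iff forall_3 field_simps)
  have unit: "lincomb L [1, 0, 0, 0] ?Y = Y1" "lincomb L [0, 1, 0, 0] ?Y = Y2"
    "lincomb L [0, 0, 1, 0] ?Y = Y3" "lincomb L [0, 0, 0, 1] ?Y = Y4"
    using Y by (simp_all add: L.scale_zero_left L.scale_one L.add_zero L.add_zero_right
        L.zero_closed)
  have fY: "f Y1 = m1" "f Y2 = m2" "f Y3 = m3" "f Y4 = m4"
    using f[of 1 0 0 0] f[of 0 1 0 0] f[of 0 0 1 0] f[of 0 0 0 1]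
    by (simp_all only: unit) (simp_all add: m vec_eq_iff forall_3 field_simps)
  have f0: "f (zero L) = 0"
    using lie_linear_zero[OF L M.real_lie_algebra_axioms lin] by simp
  have hom: "lie_hom L ?M f"
  proof (rule lie_hom_from_basis[OF L M.real_lie_algebra_axioms lin basis])
    note br' = br[unfolded level_set_brackets_def]
    have "f (bracket L Y1 Y2) = bracket ?M m1 m2" "f (bracket L Y1 Y3) = bracket ?M m1 m3"
      "f (bracket L Y1 Y4) = bracket ?M m1 m4" "f (bracket L Y2 Y3) = bracket ?M m2 m3"
      "f (bracket L Y2 Y4) = bracket ?M m2 m4" "f (bracket L Y3 Y4) = bracket ?M m3 m4"
      by (simp_all only: br' f f0)
        (simp_all add: m vec_eq_iff forall_3 field_simps power2_eq_square)
    then show "sorted_wrt (\<lambda>u v. f (bracket L u v) = bracket ?M (f u) (f v)) ?Y"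
      by (simp only: sorted_wrt.simps list.set ball_simps fY)
  qed
  have coords: "\<exists>a b c d. x = lincomb L [a, b, c, d] ?Y" if "x \<in> carrier L" for x
  proof -
    have "\<exists>!cs. length cs = length ?Y \<and> lincomb L cs ?Y = x"
      using conjunct2[OF basis[unfolded is_basis_def]] that by (rule bspec)
    then obtain cs where cs: "length cs = length ?Y" and x: "lincomb L cs ?Y = x"
      by (elim ex1E conjE)
    from cs obtain a b c d where "cs = [a, b, c, d]"
      by (auto simp: length_Suc_conv)
    with x show ?thesis by (simp only:) blast
  qed
  have line: "scale L t (lincomb L [2, 0, 1, 0] ?Y) = lincomb L [2 * t, 0, t, 0] ?Y" for t
    using L.lincomb_scale[of ?Y t "[2, 0, 1, 0]"] Y by (simp add: mult.commute)
  have closed: "lincomb L cs ?Y \<in> carrier L" for cs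
    using Y by (intro L.lincomb_closed) auto
  have "lie_line L (lincomb L [2, 0, 1, 0] ?Y) = {x \<in> carrier L. f x = zero ?M}"
  proof (intro set_eqI iffI)
    fix x assume "x \<in> lie_line L (lincomb L [2, 0, 1, 0] ?Y)"
    then obtain t where "x = lincomb L [2 * t, 0, t, 0] ?Y"
      unfolding lie_line_def line by blast
    then show "x \<in> {x \<in> carrier L. f x = zero ?M}"
      using closed by (simp del: lincomb.simps add: f vec_eq_iff forall_3)
  next
    fix x assume x: "x \<in> {x \<in> carrier L. f x = zero ?M}"
    then obtain a b c d where eq: "x = lincomb L [a, b, c, d] ?Y" using coords by blast
    with x have "b = 0" "d = 0" "a = 2 * c"
      by (auto simp del: lincomb.simps simp: f vec_eq_iff forall_3)
    with eq have "x = scale L c (lincomb L [2, 0, 1, 0] ?Y)" by (simp only: line)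
    then show "x \<in> lie_line L (lincomb L [2, 0, 1, 0] ?Y)"
      unfolding lie_line_def by blast
  qed
  moreover have "f ` carrier L = carrier ?M"
  proof -
    have "v \<in> f ` carrier L" for v
    proof (rule image_eqI)
      show "v = f (lincomb L
          [0, v$1, v$2 - v$1 * (R - S) / 2 + v$3 * (R + S) / 2, v$3] ?Y)"
        by (simp only: f) (simp add: vec_eq_iff forall_3)
    qed (rule closed)
    then show ?thesis by auto
  qed
  ultimately show ?thesis
    by (intro first_isomorphism[OF L M.real_lie_algebra_axioms hom])
qed

theorem proposition6p5:
  fixes R S T :: real
    and L :: "'a lie_alg" and Y1 Y2 Y3 Y4 :: 'a
  assumes "real_lie_algebra L"
    and "is_basis L [Y1, Y2, Y3, Y4]"
    and "level_set_brackets R S T L Y1 Y2 Y3 Y4"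
  shows "let q = lie_quotient L (lie_line L (lincomb L [2, 0, 1, 0] [Y1, Y2, Y3, Y4])) in
    (R\<^sup>2 + S\<^sup>2 < T \<longrightarrow> q \<cong>\<^sub>L so3) \<and>
    (R\<^sup>2 + S\<^sup>2 > T \<longrightarrow> q \<cong>\<^sub>L sl2) \<and>
    (R\<^sup>2 + S\<^sup>2 = T \<longrightarrow>
      (\<exists>(M :: (real ^ 3) lie_alg) x1 x2 x3.
         real_lie_algebra M \<and> solvable M \<and> is_basis M [x1, x2, x3] \<and>
         bracket M x2 x3 = x1 \<and> bracket M x3 x1 = x2 \<and> bracket M x1 x2 = zero M \<and>
         q \<cong>\<^sub>L M))"
proof -
  define q where "q = lie_quotient L (lie_line L (lincomb L [2, 0, 1, 0] [Y1, Y2, Y3, Y4]))"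
  have q: "q \<cong>\<^sub>L milnor_algebra 2 (T - R\<^sup>2 - S\<^sup>2) 2"
    unfolding q_def using assms by (rule quotient_iso_milnor)
  have "q \<cong>\<^sub>L so3" if "R\<^sup>2 + S\<^sup>2 < T"
    using that by (intro lie_iso_trans[OF q] milnor_iso_so3) simp
  moreover have "q \<cong>\<^sub>L sl2" if "R\<^sup>2 + S\<^sup>2 > T"
    using that by (intro lie_iso_trans[OF q] milnor_iso_sl2) simp
  moreover have "\<exists>(M :: (real ^ 3) lie_alg) x1 x2 x3.
      real_lie_algebra M \<and> solvable M \<and> is_basis M [x1, x2, x3] \<and>
      bracket M x2 x3 = x1 \<and> bracket M x3 x1 = x2 \<and> bracket M x1 x2 = zero M \<and> q \<cong>\<^sub>L M"
    if "R\<^sup>2 + S\<^sup>2 = T"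
  proof -
    let ?M = "milnor_algebra 2 0 2"
    \<comment> \<open>Half of \<open>f\<^sub>2\<close> acts on the plane of \<open>f\<^sub>3\<close> and \<open>f\<^sub>1\<close> as a quarter turn.\<close>
    define x1 x2 x3 :: "real ^ 3" where
      "x1 = vector [0, 0, 1]" and "x2 = vector [1, 0, 0]" and "x3 = vector [0, 1 / 2, 0]"
    note x = x1_def x2_def x3_def
    have comb: "lincomb ?M [a, b, c] [x1, x2, x3] = vector [b, c / 2, a]" for a b c
      by (simp add: x vec_eq_iff forall_3)
    have "is_basis ?M [x1, x2, x3]"
      unfolding is_basis_def
    proof (intro conjI ballI ex1I)
      fix v :: "real ^ 3"
      show "lincomb ?M [v$3, v$1, 2 * v$2] [x1, x2, x3] = v"
        by (simp only: comb) (simp add: vec_eq_iff forall_3)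
      fix cs assume cs: "length cs = length [x1, x2, x3] \<and> lincomb ?M cs [x1, x2, x3] = v"
      then obtain a b c where "cs = [a, b, c]" by (auto simp: length_Suc_conv)
      with cs show "cs = [v$3, v$1, 2 * v$2]" by (auto simp only: comb) auto
    qed auto
    moreover have "q \<cong>\<^sub>L ?M"
      using q that by (metis diff_diff_eq diff_self)
    moreover have "bracket ?M x2 x3 = x1" "bracket ?M x3 x1 = x2" "bracket ?M x1 x2 = zero ?M"
      by (simp_all add: x vec_eq_iff forall_3)
    ultimately show ?thesis
      using real_lie_algebra_milnor solvable_milnor by blast
  qed
  ultimately show ?thesis
    unfolding Let_def q_def[symmetric] by blast
qed

end
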